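(* Let $n\geq 8$ and $a$ be integers with $2\leq a<\frac{n}{2}$ and $(n,a)\neq(8,3)$, and let $\overline{\Gamma}=\overline{C_n(1,a)}$ be the complement of the circulant graph $C_n(1,a)$. Then for every vertex $v\in\{0,1,\ldots,n-1\}$, $$d_{\overline{\Gamma}}(0,v)=\begin{cases}0 & \text{if } v=0,\\ 2 & \text{if } v\in\{1,a,n-a,n-1\},\\ 1 & \text{otherwise.}\end{cases}$$
   Context: For $S\subseteq\mathbb{Z}_n\setminus\{0\}$, the circulant graph $C_n(S)$ is the simple undirected graph with vertex set $\mathbb{Z}_n=\{0,1,\ldots,n-1\}$ and edge set $\{\{g,g+s\}: g\in\mathbb{Z}_n, s\in S\}$ (addition mod $n$); $C_n(1,a)$ means $C_n(\{1,a\})$. $\overline{\Gamma}$ denotes the complement of the graph $\Gamma$, and $d_{\Gamma}(u,v)$ is the length of a shortest path between $u$ and $v$ in $\Gamma$. *)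

theory Defs
  imports "Graph_Theory.Graph_Theory" "HOL-Library.Extended_Nat"
begin

text \<open>
  As in the \<open>Graph_Theory\<close> entry, simple undirected graphs are symmetric loop-free digraphs without
  parallel arcs (\<^locale>\<open>pair_graph\<close>): an edge \<open>{u, v}\<close> is represented by the two arcs
  \<open>(u, v)\<close> and \<open>(v, u)\<close>.
\<close>

text \<open>
  \<open>\<int>\<^sub>n\<close> is represented by its residues \<open>{0..<n}\<close>; the connection set is meant to satisfy
  \<open>S \<subseteq> {1..<n}\<close>.
\<close>
definition circulant :: "nat \<Rightarrow> nat set \<Rightarrow> nat pair_pre_digraph" where
  "circulant n S =
    \<lparr> pverts = {0..<n},
      parcs = {(u, v). \<exists>g\<in>{0..<n}. \<exists>s\<in>S. {u, v} = {g, (g + s) mod n}} \<rparr>"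

definition graph_complement :: "'a pair_pre_digraph \<Rightarrow> 'a pair_pre_digraph" where
  "graph_complement G =
    \<lparr> pverts = pverts G,
      parcs = {(u, v). u \<in> pverts G \<and> v \<in> pverts G \<and> u \<noteq> v \<and> (u, v) \<notin> parcs G} \<rparr>"

text \<open>
  The infimum over the empty set in \<^typ>\<open>enat\<close> is \<open>\<infinity>\<close>, which is thus the distance between vertices
  not joined by a path.
\<close>
definition graph_dist :: "('a, 'b) pre_digraph \<Rightarrow> 'a \<Rightarrow> 'a \<Rightarrow> enat" where
  "graph_dist G u v = (INF p\<in>{p. pre_digraph.apath G u p v}. enat (length p))"

lemma add_mod_neq_self:
  fixes g s n :: nat
  assumes "g < n" "0 < s" "s < n"
  shows "(g + s) mod n \<noteq> g"
  using assms by (cases "g + s < n") (auto simp: le_mod_geq)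

lemma circulant_arcE:
  assumes "(u, v) \<in> parcs (circulant n S)"
  obtains g s where "g < n" "s \<in> S" "{u, v} = {g, (g + s) mod n}"
  using assms by (auto simp: circulant_def)

lemma pair_graph_circulant:
  assumes S: "S \<subseteq> {1..<n}"
  shows "pair_graph (circulant n S)"
proof -
  have arc: "u < n \<and> v < n \<and> u \<noteq> v \<and> (v, u) \<in> parcs (circulant n S)"
    if uv: "(u, v) \<in> parcs (circulant n S)" for u v
  proof -
    obtain g s where gs: "g < n" "s \<in> S" "{u, v} = {g, (g + s) mod n}"
      using uv by (rule circulant_arcE)
    from S gs(2) have s: "0 < s" "s < n"
      by auto
    have "(g + s) mod n \<noteq> g" "(g + s) mod n < n"
      using add_mod_neq_self[OF gs(1) s] s by auto
    with gs(1,3) have "u < n" "v < n" "u \<noteq> v"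
      by (auto simp: doubleton_eq_iff)
    moreover have "{v, u} = {g, (g + s) mod n}"
      using gs(3) by (simp only: insert_commute)
    then have "(v, u) \<in> parcs (circulant n S)"
      unfolding circulant_def using gs(1,2) by (simp only: pair_pre_digraph.simps) fastforce
    ultimately show ?thesis by blast
  qed
  have verts: "pverts (circulant n S) = {0..<n}"
    by (simp add: circulant_def)
  show ?thesis
  proof
    show "finite (parcs (circulant n S))"
      by (rule finite_subset[of _ "{0..<n} \<times> {0..<n}"]) (use arc in auto)
    show "symmetric (with_proj (circulant n S))"
      unfolding symmetric_def with_proj_simps by (rule symI) (use arc in blast)
  qed (use arc verts in \<open>force+\<close>)
qed

lemma pair_graph_complement:
  assumes "pair_graph G"
  shows "pair_graph (graph_complement G)"
proof -
  interpret pair_graph G by fact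
  show ?thesis
  proof
    show "finite (parcs (graph_complement G))"
      by (rule finite_subset[of _ "pverts G \<times> pverts G"])
        (auto simp: graph_complement_def pair_finite_verts)
    show "symmetric (with_proj (graph_complement G))"
      unfolding symmetric_def with_proj_simps
      by (rule symI) (auto simp: graph_complement_def dest: arcs_symmetric)
  qed (auto simp: graph_complement_def pair_finite_verts)
qed

end

theory Submission
  imports Defs
begin

text \<open>
  Write \<open>N[x]\<close> for the closed neighbourhood \<open>x + {0, 1, a, -a, -1}\<close> of \<open>x\<close> in \<open>C\<^sub>n(1,a)\<close>.  In the
  complement, \<open>x\<close> is adjacent exactly to the vertices outside \<open>N[x]\<close>, so the distance from \<open>0\<close> is \<open>1\<close>
  off \<open>N[0] = {0, 1, a, n - a, n - 1}\<close> and at least \<open>2\<close> on \<open>N[0] - {0}\<close>.  It remains to find, for a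
  vertex \<open>v \<noteq> 0\<close> in \<open>N[0]\<close>, a common neighbour of \<open>0\<close> and \<open>v\<close> in the complement, that is, a vertex
  outside \<open>N[0] \<union> N[v]\<close>.  Each closed neighbourhood has at most five elements, and these two share the
  elements \<open>0\<close> and \<open>v\<close>, because adjacency in \<open>C\<^sub>n(1,a)\<close> is symmetric.  So the union has at most eight
  elements and misses a vertex as soon as \<open>n \<ge> 9\<close>.  For \<open>n = 8\<close> only \<open>a = 2\<close> is left, and there a
  common neighbour can be named.  The pair \<open>(8, 3)\<close> is a true exception: \<open>C\<^sub>8(1,3)\<close> is the complete
  bipartite graph on even and odd vertices, whose complement is disconnected.
\<close>

lemma graph_dist_eqI:
  assumes "pre_digraph.apath G u p v"
    and "\<And>q. pre_digraph.apath G u q v \<Longrightarrow> length p \<le> length q"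
  shows "graph_dist G u v = enat (length p)"
  unfolding graph_dist_def
proof (rule antisym)
  show "(INF q\<in>{q. pre_digraph.apath G u q v}. enat (length q)) \<le> enat (length p)"
    using assms(1) by (intro INF_lower) simp
  show "enat (length p) \<le> (INF q\<in>{q. pre_digraph.apath G u q v}. enat (length q))"
    using assms(2) by (intro INF_greatest) simp
qed

context wf_digraph
begin

lemma graph_dist_self:
  assumes "u \<in> verts G"
  shows "graph_dist G u u = 0"
  using graph_dist_eqI[of G u "[]" u] assms
  by (simp add: apath_Nil_iff zero_enat_def)

lemma graph_dist_adjacent:
  assumes "u \<rightarrow> v" "u \<noteq> v"
  shows "graph_dist G u v = 1"
proof -
  obtain e where e: "e \<in> arcs G" "tail G e = u" "head G e = v"
    using assms(1) by auto
  have "apath u [e] v"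
    using e assms by (auto simp: apath_def awalk_simps)
  moreover have "length [e] \<le> length q" if "apath u q v" for q
    using that assms(2) by (cases q) (auto simp: apath_Nil_iff)
  ultimately show ?thesis
    using graph_dist_eqI[of G u "[e]" v] by (simp add: one_enat_def)
qed

lemma graph_dist_common_neighbour:
  assumes "u \<rightarrow> w" "w \<rightarrow> v" "\<not> u \<rightarrow> v" "u \<noteq> v"
  shows "graph_dist G u v = 2"
proof -
  obtain e where e: "e \<in> arcs G" "tail G e = u" "head G e = w"
    using assms(1) by auto
  obtain f where f: "f \<in> arcs G" "tail G f = w" "head G f = v"
    using assms(2) by auto
  have "u \<noteq> w" "w \<noteq> v"
    using assms by auto
  then have "apath u [e, f] v"
    using e f assms by (auto simp: apath_def awalk_simps)
  moreover have "length [e, f] \<le> length q" if q: "apath u q v" for q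
  proof (rule ccontr)
    assume "\<not> length [e, f] \<le> length q"
    then consider "q = []" | g where "q = [g]"
      by (cases q; cases "tl q") auto
    then show False
    proof cases
      case 1
      then show False using q assms(4) by (simp add: apath_Nil_iff)
    next
      case (2 g)
      then have "g \<in> arcs G" "tail G g = u" "head G g = v"
        using q by (auto simp: apath_def awalk_simps)
      then show False using assms(3) in_arcs_imp_in_arcs_ends by fastforce
    qed
  qed
  ultimately show ?thesis
    using graph_dist_eqI[of G u "[e, f]" v] by (simp add: numeral_eq_enat)
qed

end

definition closed_nbhd :: "nat \<Rightarrow> nat \<Rightarrow> nat \<Rightarrow> nat set" where
  "closed_nbhd n a x = (\<lambda>s. (x + s) mod n) ` {0, 1, a, n - a, n - 1}"

lemma closed_nbhd_0:
  assumes "2 \<le> a" "2 * a < n"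
  shows "closed_nbhd n a 0 = {0, 1, a, n - a, n - 1}"
  using assms by (auto simp: closed_nbhd_def)

lemma finite_closed_nbhd: "finite (closed_nbhd n a x)"
  by (simp add: closed_nbhd_def)

lemma card_closed_nbhd: "card (closed_nbhd n a x) \<le> 5"
proof -
  have "card (closed_nbhd n a x) \<le> card {0, 1, a, n - a, n - 1}"
    unfolding closed_nbhd_def by (rule card_image_le) simp
  also have "\<dots> \<le> 5"
    by (simp add: card_insert_if)
  finally show ?thesis .
qed

lemma mod_add_eq_iff_complement:
  fixes x y s n :: nat
  assumes "x < n" "y < n" "s \<le> n"
  shows "y = (x + (n - s)) mod n \<longleftrightarrow> x = (y + s) mod n"
proof
  assume "y = (x + (n - s)) mod n"
  then have "(y + s) mod n = (x + (n - s) + s) mod n"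
    by (simp add: mod_add_left_eq)
  then show "x = (y + s) mod n" using assms by simp
next
  assume "x = (y + s) mod n"
  then have "(x + (n - s)) mod n = (y + s + (n - s)) mod n"
    by (simp add: mod_add_left_eq)
  then show "y = (x + (n - s)) mod n" using assms by simp
qed

lemma mem_closed_nbhd_iff:
  assumes "a < n" "x < n" "y < n"
  shows "y \<in> closed_nbhd n a x \<longleftrightarrow>
    x = y \<or> (\<exists>s\<in>{1, a}. y = (x + s) mod n \<or> x = (y + s) mod n)"
proof -
  have "y \<in> closed_nbhd n a x \<longleftrightarrow> y = x mod n \<or> y = (x + 1) mod n \<or> y = (x + a) mod n \<or>
      y = (x + (n - a)) mod n \<or> y = (x + (n - 1)) mod n"
    unfolding closed_nbhd_def by (simp add: image_iff)
  moreover have "y = (x + (n - a)) mod n \<longleftrightarrow> x = (y + a) mod n"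
      "y = (x + (n - 1)) mod n \<longleftrightarrow> x = (y + 1) mod n"
    using assms by (intro mod_add_eq_iff_complement; simp)+
  ultimately show ?thesis using assms by auto
qed

lemma closed_nbhd_sym:
  assumes "a < n" "x < n" "y < n"
  shows "y \<in> closed_nbhd n a x \<longleftrightarrow> x \<in> closed_nbhd n a y"
  using mem_closed_nbhd_iff[OF assms] mem_closed_nbhd_iff[OF assms(1,3,2)] by blast

lemma parcs_complement_circulant_iff:
  assumes "a < n" "x < n" "y < n"
  shows "(x, y) \<in> parcs (graph_complement (circulant n {1, a})) \<longleftrightarrow> y \<notin> closed_nbhd n a x"
proof -
  have "(x, y) \<in> parcs (circulant n {1, a}) \<longleftrightarrow>
      (\<exists>s\<in>{1, a}. y = (x + s) mod n \<or> x = (y + s) mod n)"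
    using assms(2,3) by (auto simp: circulant_def doubleton_eq_iff)
  moreover have "(x, y) \<in> parcs (graph_complement (circulant n {1, a})) \<longleftrightarrow>
      x \<noteq> y \<and> (x, y) \<notin> parcs (circulant n {1, a})"
    using assms(2,3) by (simp add: graph_complement_def circulant_def)
  ultimately show ?thesis
    using mem_closed_nbhd_iff[OF assms] by blast
qed

text \<open>
  Inclusion-exclusion: \<open>5 + 5 - 2 = 8\<close>.  Only for \<open>n = 8\<close> can the union be everything; there \<open>a = 2\<close>,
  and \<open>N[0] = {0, 1, 2, 6, 7}\<close> leaves \<open>4\<close> and \<open>5\<close> for \<open>v = 1\<close>, \<open>5\<close> for \<open>v = 2\<close>, and by negation
  \<open>3\<close> and \<open>4\<close> for \<open>v = 7\<close>, \<open>3\<close> for \<open>v = 6\<close>.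
\<close>
lemma closed_nbhds_not_cover:
  assumes n: "n \<ge> 8" and a: "2 \<le> a" "2 * a < n" and "(n, a) \<noteq> (8, 3)"
    and v: "v \<in> closed_nbhd n a 0" "v \<noteq> 0"
  obtains w where "w < n" "w \<notin> closed_nbhd n a 0" "w \<notin> closed_nbhd n a v"
proof (cases "n = 8")
  case True
  then have [simp]: "n = 8" "a = 2"
    using assms by auto
  have "v \<in> {1, 2, 6, 7}"
    using v closed_nbhd_0[OF a] by auto
  then have "(if v \<le> 2 then 5 else 3) \<notin> closed_nbhd n a 0 \<union> closed_nbhd n a v"
    by (auto simp: closed_nbhd_def)
  then show ?thesis
    using that[of "if v \<le> 2 then 5 else 3"] by auto
next
  case False
  let ?A = "closed_nbhd n a 0" and ?B = "closed_nbhd n a v"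
  have "v < n"
    using v a closed_nbhd_0[OF a] by auto
  have "{0, v} \<subseteq> ?A \<inter> ?B"
    using v closed_nbhd_0[OF a] closed_nbhd_sym[of a n 0 v] mem_closed_nbhd_iff[of a n v v] \<open>v < n\<close> a
    by auto
  then have "card {0, v} \<le> card (?A \<inter> ?B)"
    by (intro card_mono) (auto simp: finite_closed_nbhd)
  moreover have "card {0, v} = 2"
    using v by simp
  moreover have "card (?A \<union> ?B) + card (?A \<inter> ?B) = card ?A + card ?B"
    using card_Un_Int[of ?A ?B] by (simp add: finite_closed_nbhd)
  ultimately have "card (?A \<union> ?B) < card {0..<n}"
    using card_closed_nbhd[of n a 0] card_closed_nbhd[of n a v] n False by simp
  then have "\<not> {0..<n} \<subseteq> ?A \<union> ?B"
    using card_mono[of "?A \<union> ?B" "{0..<n}"] by (auto simp: finite_closed_nbhd)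
  then obtain w where "w \<in> {0..<n}" "w \<notin> ?A \<union> ?B"
    by blast
  then show ?thesis using that[of w] by simp
qed

theorem theorem3p2:
  fixes n a v :: nat
  assumes "n \<ge> 8"
    and "2 \<le> a" and "2 * a < n"
    and "(n, a) \<noteq> (8, 3)"
    and "v \<in> {0..n - 1}"
  shows "graph_dist (with_proj (graph_complement (circulant n {1, a}))) 0 v =
    (if v = 0 then 0
     else if v \<in> {1, a, n - a, n - 1} then 2
     else 1)"
proof -
  let ?H = "graph_complement (circulant n {1, a})"
  have a: "a < n" and v: "v < n" and n: "0 < n"
    using assms by auto
  interpret H: pair_graph ?H
    using assms by (intro pair_graph_complement pair_graph_circulant) auto
  have arc: "x \<rightarrow>\<^bsub>with_proj ?H\<^esub> y \<longleftrightarrow> y \<notin> closed_nbhd n a x" if "x < n" "y < n" for x y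
    using parcs_complement_circulant_iff[OF a that] by simp
  have N0: "closed_nbhd n a 0 = {0, 1, a, n - a, n - 1}"
    using assms by (intro closed_nbhd_0)
  consider "v = 0" | "v \<noteq> 0" "v \<in> closed_nbhd n a 0" | "v \<notin> closed_nbhd n a 0"
    by blast
  then show ?thesis
  proof cases
    case 1
    then show ?thesis
      using n H.graph_dist_self[of 0] by (simp add: graph_complement_def circulant_def)
  next
    case 2
    obtain w where w: "w < n" "w \<notin> closed_nbhd n a 0" "w \<notin> closed_nbhd n a v"
      using closed_nbhds_not_cover[OF assms(1-4) 2(2,1)] .
    have "v \<notin> closed_nbhd n a w"
      using w(3) closed_nbhd_sym[OF a v w(1)] by simp
    then have "graph_dist (with_proj ?H) 0 v = 2"
      using 2 w n v arc by (intro H.graph_dist_common_neighbour[of 0 w v]) auto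
    then show ?thesis
      using 2 N0 by auto
  next
    case 3
    then have "v \<noteq> 0"
      using N0 by auto
    moreover from this have "graph_dist (with_proj ?H) 0 v = 1"
      using 3 n v arc by (intro H.graph_dist_adjacent) auto
    ultimately show ?thesis
      using 3 N0 by auto
  qed
qed

end
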